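(* A Cameron--Walker graph is levelable if and only if it has no exceptional vertex.
   Context: All graphs are finite and simple. A Cameron--Walker graph is a finite graph consisting of a connected bipartite graph with vertex partition $U\cup V$ such that there is at least one leaf (pendant edge, whose other endpoint is a new vertex of degree one) attached to each $x\in U$, and such that there are possibly some (zero or more) pendant triangles attached to each $y\in V$ (a pendant triangle at $y$ consists of two new vertices $v,w$, each of degree two, together with the edges $\{y,v\},\{y,w\},\{v,w\}$). A vertex $y\in V$ is called exceptional if there is no pendant triangle attached to $y$. It is assumed that for each exceptional $y\in V$ there exist $x,x'\in U$ with $x\neq x'$ such that $\{x,y\}$ and $\{x',y\}$ are edges of the graph. A graph $G$ on $\{x_1,\ldots,x_n\}$ is levelable if there exist positive integers $c_1,\ldots,c_n$ and a constant $c$ such that $\sum_{x_i\in W}c_i=c$ for every maximal (under inclusion) independent set $W$ of $G$. *)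

theory Defs
  imports "Graph_Theory.Digraph_Component"
begin

text \<open>
  Finite simple graphs are the finite, symmetric, loop-free digraphs without parallel arcs of the
  locale \<open>graph\<close>. Every edge is a pair of opposite arcs, so \<open>out_degree\<close> is the usual degree.
\<close>

text \<open>
  The argument \<open>B\<close> below stands for the vertex set of the bipartite graph to which leaves and
  triangles are attached; the vertices of the attached pieces are new, i.e. outside \<open>B\<close>.
\<close>

definition leaf_at :: "('a, 'b) pre_digraph \<Rightarrow> 'a set \<Rightarrow> 'a \<Rightarrow> 'a \<Rightarrow> bool" where
  "leaf_at G B x z \<longleftrightarrow>
     z \<in> verts G \<and> z \<notin> B \<and> x \<rightarrow>\<^bsub>G\<^esub> z \<and> out_degree G z = 1"

definition pendant_triangle_at ::
    "('a, 'b) pre_digraph \<Rightarrow> 'a set \<Rightarrow> 'a \<Rightarrow> 'a \<Rightarrow> 'a \<Rightarrow> bool" where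
  "pendant_triangle_at G B y v w \<longleftrightarrow>
     v \<in> verts G \<and> w \<in> verts G \<and> v \<notin> B \<and> w \<notin> B \<and> v \<noteq> w \<and>
     y \<rightarrow>\<^bsub>G\<^esub> v \<and> y \<rightarrow>\<^bsub>G\<^esub> w \<and> v \<rightarrow>\<^bsub>G\<^esub> w \<and>
     out_degree G v = 2 \<and> out_degree G w = 2"

definition exceptional :: "('a, 'b) pre_digraph \<Rightarrow> 'a set \<Rightarrow> 'a set \<Rightarrow> 'a \<Rightarrow> bool" where
  "exceptional G U V y \<longleftrightarrow>
     y \<in> V \<and> \<not> (\<exists>v w. pendant_triangle_at G (U \<union> V) y v w)"

text \<open>
  \<open>G\<close> is a Cameron--Walker graph built on the connected bipartite graph \<open>G \<restriction> (U \<union> V)\<close>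
  with vertex partition \<open>U \<union> V\<close>. Connectedness makes \<open>U \<union> V\<close> nonempty, but one of \<open>U\<close>, \<open>V\<close>
  may be empty (stars and bouquets of triangles). The degree conditions in \<open>leaf_at\<close> and
  \<open>pendant_triangle_at\<close> together with \<open>attached\<close> rule out any edge outside the bipartite graph
  other than those of the attached leaves and triangles.
\<close>

locale cameron_walker = graph G for G :: "('a, 'b) pre_digraph" +
  fixes U V :: "'a set"
  assumes parts_subset: "U \<union> V \<subseteq> verts G"
    and parts_disjoint: "U \<inter> V = {}"
    and core_connected: "connected (G \<restriction> (U \<union> V))"
    and no_edge_in_U: "\<lbrakk>x \<in> U; x' \<in> U\<rbrakk> \<Longrightarrow> \<not> x \<rightarrow>\<^bsub>G\<^esub> x'"
    and no_edge_in_V: "\<lbrakk>y \<in> V; y' \<in> V\<rbrakk> \<Longrightarrow> \<not> y \<rightarrow>\<^bsub>G\<^esub> y'"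
    and leaf_exists: "x \<in> U \<Longrightarrow> \<exists>z. leaf_at G (U \<union> V) x z"
    and attached: "z \<in> verts G - (U \<union> V) \<Longrightarrow>
       (\<exists>x\<in>U. leaf_at G (U \<union> V) x z) \<or> (\<exists>y\<in>V. \<exists>w. pendant_triangle_at G (U \<union> V) y z w)"
    and exceptional_two_neighbours: "exceptional G U V y \<Longrightarrow>
       \<exists>x\<in>U. \<exists>x'\<in>U. x \<noteq> x' \<and> x \<rightarrow>\<^bsub>G\<^esub> y \<and> x' \<rightarrow>\<^bsub>G\<^esub> y"

definition independent_set :: "('a, 'b) pre_digraph \<Rightarrow> 'a set \<Rightarrow> bool" where
  "independent_set G W \<longleftrightarrow> W \<subseteq> verts G \<and> (\<forall>u\<in>W. \<forall>v\<in>W. \<not> u \<rightarrow>\<^bsub>G\<^esub> v)"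

definition maximal_independent_set :: "('a, 'b) pre_digraph \<Rightarrow> 'a set \<Rightarrow> bool" where
  "maximal_independent_set G W \<longleftrightarrow>
     independent_set G W \<and> (\<forall>W'. independent_set G W' \<and> W \<subseteq> W' \<longrightarrow> W' = W)"

definition levelable :: "('a, 'b) pre_digraph \<Rightarrow> bool" where
  "levelable G \<longleftrightarrow>
     (\<exists>(c :: 'a \<Rightarrow> nat) (s :: nat).
        (\<forall>x\<in>verts G. c x > 0) \<and>
        (\<forall>W. maximal_independent_set G W \<longrightarrow> (\<Sum>x\<in>W. c x) = s))"

end

theory Submission
  imports Defs
begin

text \<open>
  If every vertex of \<open>V\<close> carries a triangle, give every attached vertex weight 2, every
  \<open>x \<in> U\<close> twice the number of its leaves, and every \<open>y \<in> V\<close> the number of its triangle vertices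
  (two for each triangle). A maximal independent set contains either a core vertex \<open>u\<close>, or all
  leaves of \<open>u\<close>, respectively one vertex of each triangle at \<open>u\<close>; both alternatives weigh the same.

  Conversely, let \<open>y\<close> be exceptional with neighbours \<open>x \<noteq> x'\<close> in \<open>U\<close>. Any \<open>A \<subseteq> U\<close> extends to a
  maximal independent set \<open>W A\<close> by the leaves of \<open>U - A\<close>, one vertex of every triangle, and the
  exceptional vertices without neighbour in \<open>A\<close>. Comparing the weights for \<open>A = {}\<close>, \<open>{x}\<close>, \<open>{x'}\<close>,
  \<open>{x, x'}\<close> shows that the common exceptional neighbours of \<open>x\<close> and \<open>x'\<close> have total weight 0,
  although \<open>y\<close> is one of them.
\<close>

section \<open>Maximal independent sets, and vertices of degree one or two\<close>

lemma (in graph) maximal_independent_set_iff_dominating: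
  "maximal_independent_set G W \<longleftrightarrow>
     independent_set G W \<and> (\<forall>u\<in>verts G - W. \<exists>v\<in>W. u \<rightarrow>\<^bsub>G\<^esub> v)"
proof (intro iffI conjI ballI)
  fix u assume W: "maximal_independent_set G W" and u: "u \<in> verts G - W"
  have ind: "independent_set G W" using W by (simp add: maximal_independent_set_def)
  \<comment> \<open>Maximality forbids adding \<open>u\<close>. As there are no loops and adjacency
    is symmetric, an arc from \<open>u\<close> into \<open>W\<close> must be the
    obstruction.\<close>
  have "\<not> independent_set G (insert u W)"
    using W u unfolding maximal_independent_set_def by blast
  then show "\<exists>v\<in>W. u \<rightarrow>\<^bsub>G\<^esub> v"
    using ind u graph_symmetric adj_not_same unfolding independent_set_def by blast
qed (auto simp: maximal_independent_set_def independent_set_def, blast)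

lemma out_degree_1_neighbour_unique:
  assumes "out_degree G z = 1" "z \<rightarrow>\<^bsub>G\<^esub> a" "z \<rightarrow>\<^bsub>G\<^esub> b"
  shows "a = b"
proof -
  obtain e f where "e \<in> out_arcs G z" "head G e = a" "f \<in> out_arcs G z" "head G f = b"
    using assms(2,3) by (auto simp: arcs_ends_def arc_to_ends_def)
  with assms(1) show ?thesis by (metis One_nat_def card_1_singletonE out_degree_def singletonD)
qed

lemma out_degree_2_neighbour_cases:
  assumes "out_degree G z = 2" "z \<rightarrow>\<^bsub>G\<^esub> a" "z \<rightarrow>\<^bsub>G\<^esub> b" "a \<noteq> b" "z \<rightarrow>\<^bsub>G\<^esub> d"
  shows "d = a \<or> d = b"
proof -
  obtain e f g where "e \<in> out_arcs G z" "head G e = a" "f \<in> out_arcs G z" "head G f = b"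
    "g \<in> out_arcs G z" "head G g = d"
    using assms(2,3,5) by (auto simp: arcs_ends_def arc_to_ends_def)
  moreover obtain p q where "out_arcs G z = {p, q}"
    using assms(1) by (auto simp: out_degree_def card_2_iff)
  ultimately show ?thesis using assms(4) by (metis insertE singletonD)
qed

section \<open>Pendant vertices and their attachment points\<close>

context cameron_walker
begin

abbreviation leaf :: "'a \<Rightarrow> 'a \<Rightarrow> bool" where
  "leaf \<equiv> leaf_at G (U \<union> V)"

abbreviation triangle :: "'a \<Rightarrow> 'a \<Rightarrow> 'a \<Rightarrow> bool" where
  "triangle \<equiv> pendant_triangle_at G (U \<union> V)"

text \<open>Treats leaves and triangle vertices uniformly: the blocks
  \<open>insert u (pendants u)\<close> for \<open>u\<close> in \<open>U \<union> V\<close> partition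
  the vertex set.\<close>

definition pendants :: "'a \<Rightarrow> 'a set" where
  "pendants u = {z \<in> verts G - (U \<union> V). u \<rightarrow>\<^bsub>G\<^esub> z}"

lemma leaf_neighbour:
  assumes "leaf x z" "z \<rightarrow>\<^bsub>G\<^esub> a"
  shows "a = x"
  using assms out_degree_1_neighbour_unique graph_symmetric
  unfolding leaf_at_def by metis

lemma triangle_sym:
  "triangle y v w \<Longrightarrow> triangle y w v"
  using graph_symmetric unfolding pendant_triangle_at_def by blast

lemma triangle_neighbour:
  assumes "triangle y v w" "y \<in> U \<union> V" "v \<rightarrow>\<^bsub>G\<^esub> a"
  shows "a = y \<or> a = w"
proof (rule out_degree_2_neighbour_cases)
  show "out_degree G v = 2" "v \<rightarrow>\<^bsub>G\<^esub> y" "v \<rightarrow>\<^bsub>G\<^esub> w" "y \<noteq> w" "v \<rightarrow>\<^bsub>G\<^esub> a"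
    using assms graph_symmetric unfolding pendant_triangle_at_def by auto
qed

lemma pendant_cases:
  assumes "z \<in> verts G - (U \<union> V)"
  obtains (leaf) x where "x \<in> U" "leaf x z" "z \<in> pendants x"
    | (triangle) y w where "y \<in> V" "triangle y z w" "z \<in> pendants y"
  using attached[OF assms] assms
  unfolding pendants_def leaf_at_def pendant_triangle_at_def by blast

text \<open>The degrees leave no room for a second core neighbour: a leaf has a single neighbour,
  and the other neighbour of a triangle vertex is again outside the core.\<close>

lemma pendants_disjoint:
  assumes "z \<in> pendants u" "z \<in> pendants u'" "u \<in> U \<union> V" "u' \<in> U \<union> V"
  shows "u = u'"
proof -
  have z: "z \<in> verts G - (U \<union> V)" "z \<rightarrow>\<^bsub>G\<^esub> u" "z \<rightarrow>\<^bsub>G\<^esub> u'"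
    using assms graph_symmetric by (auto simp: pendants_def)
  from z(1) show ?thesis
  proof (cases rule: pendant_cases)
    case (leaf x)
    then show ?thesis using leaf_neighbour z by blast
  next
    case (triangle y w)
    then have "w \<notin> U \<union> V" by (simp add: pendant_triangle_at_def)
    then show ?thesis using triangle triangle_neighbour z assms(3,4) by blast
  qed
qed

lemma pendant_of_U:
  assumes "x \<in> U" "z \<in> pendants x"
  shows "leaf x z"
proof -
  have "z \<in> verts G - (U \<union> V)" using assms by (simp add: pendants_def)
  then show ?thesis
    using assms parts_disjoint pendants_disjoint by (cases rule: pendant_cases) blast+
qed

lemma pendant_of_V:
  assumes "y \<in> V" "v \<in> pendants y"
  shows "\<exists>w. triangle y v w"
proof -
  have "v \<in> verts G - (U \<union> V)" using assms by (simp add: pendants_def)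
  then show ?thesis
    using assms parts_disjoint pendants_disjoint by (cases rule: pendant_cases) blast+
qed

lemma triangle_in_pendants: "triangle y v w \<Longrightarrow> v \<in> pendants y \<and> w \<in> pendants y"
  by (auto simp: pendants_def pendant_triangle_at_def)

lemma finite_pendants [simp]: "finite (pendants u)"
  by (simp add: pendants_def)

lemma triangle_unique:
  assumes "y \<in> V" "triangle y v w" "triangle y v w'"
  shows "w = w'"
proof -
  have "v \<rightarrow>\<^bsub>G\<^esub> w" "w \<noteq> y" using assms by (auto simp: pendant_triangle_at_def)
  then show ?thesis using triangle_neighbour[OF assms(3)] assms(1) by blast
qed

text \<open>Passing to the partner in the triangle is an involution \<open>p\<close>. As
  \<open>y\<close> is missing, only the partner can dominate a vertex outside \<open>W\<close>, and
  independence forbids taking both; so \<open>p\<close> swaps \<open>pendants y \<inter> W\<close>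
  and \<open>pendants y - W\<close>.\<close>

lemma card_pendants_of_V:
  assumes W: "maximal_independent_set G W" and y: "y \<in> V" "y \<notin> W"
  shows "card (pendants y) = 2 * card (W \<inter> pendants y)"
proof -
  define p where "p v = (SOME w. triangle y v w)" for v
  have p: "triangle y v (p v)" if "v \<in> pendants y" for v
    unfolding p_def using pendant_of_V[OF y(1) that] by (rule someI_ex)
  have pp: "p (p v) = v" "p v \<in> pendants y" if "v \<in> pendants y" for v
    using p[OF that] p triangle_sym triangle_unique[OF y(1)] triangle_in_pendants by blast+
  have in_W: "p v \<in> W" if v: "v \<in> pendants y" "v \<notin> W" for v
  proof -
    have "v \<in> verts G - W" using v by (simp add: pendants_def)
    then obtain a where "a \<in> W" "v \<rightarrow>\<^bsub>G\<^esub> a"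
      using W unfolding maximal_independent_set_iff_dominating by blast
    then show ?thesis using triangle_neighbour[OF p[OF v(1)]] y by blast
  qed
  have not_in_W: "p v \<notin> W" if v: "v \<in> pendants y" "v \<in> W" for v
    using p[OF v(1)] v W
    unfolding maximal_independent_set_def independent_set_def pendant_triangle_at_def by blast
  have "bij_betw p (pendants y \<inter> W) (pendants y - W)"
    by (rule bij_betw_byWitness[where f' = p]) (use pp in_W not_in_W in auto)
  then have "card (pendants y \<inter> W) = card (pendants y - W)" by (rule bij_betw_same_card)
  moreover have "card (pendants y) = card (pendants y \<inter> W) + card (pendants y - W)"
    by (rule card_Int_Diff) simp
  ultimately show ?thesis by (simp add: Int_commute)
qed

section \<open>Level weights in the absence of exceptional vertices\<close>

lemma levelable_if_no_exceptional:
  assumes no_exc: "\<nexists>y. exceptional G U V y"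
  shows "levelable G"
proof -
  define c where
    "c z = (if z \<in> U then 2 * card (pendants z) else if z \<in> V then card (pendants z) else 2)" for z
  have "c z > 0" for z
  proof -
    consider "z \<in> U" | "z \<in> V" | "z \<notin> U \<union> V" by blast
    then show ?thesis
    proof cases
      case 1
      then obtain l where "leaf z l" using leaf_exists by blast
      then have "pendants z \<noteq> {}" by (auto simp: pendants_def leaf_at_def)
      then show ?thesis using 1 by (simp add: c_def card_gt_0_iff)
    next
      case 2
      \<comment> \<open>The hypothesis enters here: an exceptional \<open>z\<close> would get weight
        0.\<close>
      then have "pendants z \<noteq> {}"
        using no_exc triangle_in_pendants unfolding exceptional_def by blast
      then show ?thesis using 2 by (simp add: c_def card_gt_0_iff)
    qed (simp add: c_def)
  qed
  \<comment> \<open>The constant is the weight of the whole core, because \<open>W\<close> takes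
    weight exactly \<open>c u\<close> from each block \<open>insert u (pendants u)\<close>.\<close>
  moreover have "sum c W = sum c (U \<union> V)" if W: "maximal_independent_set G W" for W
  proof -
    have ind: "W \<subseteq> verts G" "\<And>u v. u \<in> W \<Longrightarrow> v \<in> W \<Longrightarrow> \<not> u \<rightarrow>\<^bsub>G\<^esub> v"
      using W by (auto simp: maximal_independent_set_def independent_set_def)
    have fin: "finite (U \<union> V)" using parts_subset finite_verts by (rule finite_subset)
    have fibre: "sum c (W \<inter> insert u (pendants u)) = c u" if u: "u \<in> U \<union> V" for u
    proof (cases "u \<in> W")
      case True
      then have "W \<inter> insert u (pendants u) = {u}" using ind(2) by (auto simp: pendants_def)
      then show ?thesis by simp
    next
      case False
      have "sum c (W \<inter> insert u (pendants u)) = sum (\<lambda>_. 2) (W \<inter> pendants u)"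
        using False by (intro sum.cong) (auto simp: c_def pendants_def)
      then have *: "sum c (W \<inter> insert u (pendants u)) = 2 * card (W \<inter> pendants u)" by simp
      show ?thesis
      proof (cases "u \<in> U")
        case True
        \<comment> \<open>A leaf outside \<open>W\<close> could only be dominated by its sole
          neighbour \<open>u\<close>, which is not in \<open>W\<close>.\<close>
        have "z \<in> W" if z: "z \<in> pendants u" for z
        proof (rule ccontr)
          assume "z \<notin> W"
          then have "z \<in> verts G - W" using z by (simp add: pendants_def)
          then obtain a where "a \<in> W" "z \<rightarrow>\<^bsub>G\<^esub> a"
            using W unfolding maximal_independent_set_iff_dominating by blast
          then show False using leaf_neighbour[OF pendant_of_U[OF True z]] \<open>u \<notin> W\<close> by blast
        qed
        then have "W \<inter> pendants u = pendants u" by blast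
        then show ?thesis using True * by (simp add: c_def)
      next
        case False
        then show ?thesis
          using * card_pendants_of_V[OF W] u \<open>u \<notin> W\<close> by (simp add: c_def)
      qed
    qed
    have "W = (\<Union>u\<in>U \<union> V. W \<inter> insert u (pendants u))"
    proof (intro equalityI subsetI)
      fix z assume z: "z \<in> W"
      show "z \<in> (\<Union>u\<in>U \<union> V. W \<inter> insert u (pendants u))"
      proof (cases "z \<in> U \<union> V")
        case False
        then have "z \<in> verts G - (U \<union> V)" using z ind(1) by blast
        then show ?thesis using z by (cases rule: pendant_cases) blast+
      qed (use z in blast)
    qed blast
    then have "sum c W = sum c (\<Union>u\<in>U \<union> V. W \<inter> insert u (pendants u))" by simp
    also have "\<dots> = (\<Sum>u\<in>U \<union> V. sum c (W \<inter> insert u (pendants u)))"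
    proof (rule sum.UNION_disjoint[OF fin])
      show "\<forall>u\<in>U \<union> V. \<forall>u'\<in>U \<union> V. u \<noteq> u' \<longrightarrow>
          (W \<inter> insert u (pendants u)) \<inter> (W \<inter> insert u' (pendants u')) = {}"
      proof (intro ballI impI)
        fix u u' assume u: "u \<in> U \<union> V" "u' \<in> U \<union> V" "u \<noteq> u'"
        have "u \<notin> pendants u'" "u' \<notin> pendants u" using u by (auto simp: pendants_def)
        then show "(W \<inter> insert u (pendants u)) \<inter> (W \<inter> insert u' (pendants u')) = {}"
          using u pendants_disjoint by blast
      qed
    qed simp
    also have "\<dots> = sum c (U \<union> V)" using fibre by (rule sum.cong[OF refl])
    finally show ?thesis .
  qed
  ultimately show ?thesis unfolding levelable_def by blast
qed

section \<open>Maximal independent sets with prescribed trace on \<open>U\<close>\<close>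

definition triangle_vertices :: "'a set" where
  "triangle_vertices = (\<Union>y\<in>V. pendants y)"

text \<open>\<open>R\<close> is to be a triangle transversal, kept fixed while \<open>A\<close>
  varies. Non-exceptional vertices of \<open>V\<close> are left out because \<open>R\<close>
  dominates them.\<close>

definition extension :: "'a set \<Rightarrow> 'a set \<Rightarrow> 'a set" where
  "extension R A = A \<union> (\<Union>x\<in>U - A. pendants x) \<union> R
     \<union> {y. exceptional G U V y \<and> (\<forall>x\<in>A. \<not> x \<rightarrow>\<^bsub>G\<^esub> y)}"

text \<open>An inclusion-maximal independent subset of the finite set of triangle vertices dominates
  the others, so no explicit choice per triangle is needed.\<close>

lemma exists_triangle_transversal:
  obtains R where "R \<subseteq> triangle_vertices" "independent_set G R"
    "\<And>v. v \<in> triangle_vertices - R \<Longrightarrow> \<exists>w\<in>R. v \<rightarrow>\<^bsub>G\<^esub> w"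
proof -
  let ?F = "{R. R \<subseteq> triangle_vertices \<and> independent_set G R}"
  have T: "triangle_vertices \<subseteq> verts G" by (auto simp: triangle_vertices_def pendants_def)
  then have "finite triangle_vertices" using finite_verts by (rule finite_subset)
  then have "finite ?F" by simp
  moreover have "{} \<in> ?F" by (simp add: independent_set_def)
  ultimately have "\<exists>R\<in>?F. \<forall>S\<in>?F. R \<subseteq> S \<longrightarrow> R = S"
    by (intro finite_has_maximal) auto
  then obtain R where R: "R \<in> ?F" "\<forall>S\<in>?F. R \<subseteq> S \<longrightarrow> R = S" by (rule bexE)
  show thesis
  proof (rule that)
    fix v assume v: "v \<in> triangle_vertices - R"
    then have "insert v R \<notin> ?F" using R(2) by blast
    then show "\<exists>w\<in>R. v \<rightarrow>\<^bsub>G\<^esub> w"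
      using R(1) v T graph_symmetric adj_not_same unfolding independent_set_def by blast
  qed (use R(1) in auto)
qed

text \<open>Outside vertices are dominated as follows: those of \<open>U - A\<close> by their
  leaves, exceptional ones and leaves by \<open>A\<close>, other vertices of \<open>V\<close> and
  triangle vertices by \<open>R\<close>.\<close>

lemma maximal_independent_extension:
  assumes R: "R \<subseteq> triangle_vertices" "independent_set G R"
    "\<And>v. v \<in> triangle_vertices - R \<Longrightarrow> \<exists>w\<in>R. v \<rightarrow>\<^bsub>G\<^esub> w"
    and A: "A \<subseteq> U"
  shows "maximal_independent_set G (extension R A)"
proof -
  let ?E = "{y. exceptional G U V y \<and> (\<forall>x\<in>A. \<not> x \<rightarrow>\<^bsub>G\<^esub> y)}"
  let ?L = "\<Union>x\<in>U - A. pendants x"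
  have L_neighbour: "a \<in> U - A" if "z \<in> ?L" "z \<rightarrow>\<^bsub>G\<^esub> a" for z a
    using that leaf_neighbour pendant_of_U by blast
  have R_neighbour: "a \<in> V \<and> \<not> exceptional G U V a \<or> a \<in> triangle_vertices"
    if z: "z \<in> R" "z \<rightarrow>\<^bsub>G\<^esub> a" for z a
  proof -
    obtain y w where yw: "y \<in> V" "triangle y z w"
      using z(1) R(1) pendant_of_V unfolding triangle_vertices_def by blast
    then have "a = y \<or> a = w" using triangle_neighbour z(2) by blast
    then show ?thesis
      using yw triangle_in_pendants unfolding exceptional_def triangle_vertices_def by blast
  qed
  have L_outside: "z \<in> verts G - (U \<union> V)" if "z \<in> ?L" for z
    using that by (auto simp: pendants_def)
  have T_outside: "z \<in> verts G - (U \<union> V)" if "z \<in> triangle_vertices" for z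
    using that by (auto simp: pendants_def triangle_vertices_def)
  have E_V: "?E \<subseteq> V" by (auto simp: exceptional_def)
  have LT: "?L \<inter> triangle_vertices = {}"
    using pendants_disjoint parts_disjoint unfolding triangle_vertices_def by blast
  have "\<not> u \<rightarrow>\<^bsub>G\<^esub> v" if uv: "u \<in> extension R A" "v \<in> extension R A" for u v
  proof
    assume e: "u \<rightarrow>\<^bsub>G\<^esub> v"
    have e': "v \<rightarrow>\<^bsub>G\<^esub> u" using e graph_symmetric by blast
    \<comment> \<open>The symmetric premise lets one argument serve both ends of the edge. An end in
      \<open>?L\<close> would put the other end into \<open>U - A\<close>, which misses the
      extension.\<close>
    have ext: "a \<in> A \<or> a \<in> R \<or> a \<in> ?E" if "a = u \<and> b = v \<or> a = v \<and> b = u" for a b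
    proof -
      have b: "b \<notin> U - A"
        using that uv L_outside T_outside R(1) E_V parts_disjoint
        unfolding extension_def by blast
      have "a \<notin> ?L" using L_neighbour[of a b] b e e' that by blast
      then show ?thesis using that uv unfolding extension_def by blast
    qed
    \<comment> \<open>Among the possible neighbours of \<open>R\<close>, the extension contains only
      vertices of \<open>R\<close>, which is independent.\<close>
    have nR: "a \<notin> R" if ab: "a = u \<and> b = v \<or> a = v \<and> b = u" for a b
    proof
      assume a: "a \<in> R"
      have "a \<rightarrow>\<^bsub>G\<^esub> b" using ab e e' by blast
      from R_neighbour[OF a this] ext[of b a] ab a
      have "b \<in> R" using A E_V T_outside parts_disjoint by blast
      then show False using a \<open>a \<rightarrow>\<^bsub>G\<^esub> b\<close> R(2) unfolding independent_set_def by blast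
    qed
    have "u \<in> A \<or> u \<in> ?E" "v \<in> A \<or> v \<in> ?E" using ext nR by blast+
    then show False
      using e e' A E_V no_edge_in_U no_edge_in_V by blast
  qed
  moreover have "extension R A \<subseteq> verts G"
    using A R(1) parts_subset E_V L_outside T_outside unfolding extension_def by blast
  moreover have "\<exists>v\<in>extension R A. u \<rightarrow>\<^bsub>G\<^esub> v" if u: "u \<in> verts G - extension R A" for u
  proof -
    consider "u \<in> U" | "u \<in> V" "exceptional G U V u" | "u \<in> V" "\<not> exceptional G U V u"
      | "u \<notin> U \<union> V" by blast
    then show ?thesis
    proof cases
      case 1
      then obtain z where "leaf u z" using leaf_exists by blast
      then have "u \<rightarrow>\<^bsub>G\<^esub> z" "z \<in> pendants u" by (auto simp: leaf_at_def pendants_def)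
      then show ?thesis using u 1 unfolding extension_def by blast
    next
      case 2
      then show ?thesis using u graph_symmetric unfolding extension_def by blast
    next
      case 3
      then obtain v w where vw: "triangle u v w" unfolding exceptional_def by blast
      then have "v \<in> triangle_vertices"
        using 3 triangle_in_pendants unfolding triangle_vertices_def by blast
      \<comment> \<open>If \<open>v\<close> is not in \<open>R\<close>, its dominator there is
        \<open>w\<close>, since its other neighbour \<open>u\<close> lies in the core.\<close>
      then have "v \<in> R \<or> w \<in> R"
        using R(1,3) triangle_neighbour[OF vw] 3 T_outside by blast
      then show ?thesis
        using vw unfolding extension_def pendant_triangle_at_def by blast
    next
      case 4
      then have "u \<in> verts G - (U \<union> V)" using u by blast
      then show ?thesis
      proof (cases rule: pendant_cases)
        case (leaf x)
        then have "x \<in> A" "u \<rightarrow>\<^bsub>G\<^esub> x"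
          using u graph_symmetric unfolding extension_def pendants_def by blast+
        then show ?thesis unfolding extension_def by blast
      next
        case (triangle y w)
        then have "u \<in> triangle_vertices - R"
          using u unfolding extension_def triangle_vertices_def by blast
        then show ?thesis using R(3) unfolding extension_def by blast
      qed
    qed
  qed
  ultimately show ?thesis
    unfolding maximal_independent_set_iff_dominating independent_set_def by blast
qed

section \<open>Exceptional vertices contradict levelability\<close>

lemma no_exceptional_if_levelable:
  assumes "levelable G"
  shows "\<nexists>y. exceptional G U V y"
proof
  assume "\<exists>y. exceptional G U V y"
  then obtain y x x' where y: "exceptional G U V y" and x: "x \<in> U" "x' \<in> U" "x \<noteq> x'"
    and e: "x \<rightarrow>\<^bsub>G\<^esub> y" "x' \<rightarrow>\<^bsub>G\<^esub> y"
    using exceptional_two_neighbours by blast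
  obtain c :: "'a \<Rightarrow> nat" and s where c: "\<And>z. z \<in> verts G \<Longrightarrow> c z > 0"
    and s: "\<And>W. maximal_independent_set G W \<Longrightarrow> sum c W = s"
    using assms unfolding levelable_def by metis
  obtain R where R: "R \<subseteq> triangle_vertices" "independent_set G R"
    "\<And>v. v \<in> triangle_vertices - R \<Longrightarrow> \<exists>w\<in>R. v \<rightarrow>\<^bsub>G\<^esub> w"
    by (rule exists_triangle_transversal) (rule that)
  let ?W = "extension R"
  have max: "maximal_independent_set G (?W A)" if "A \<subseteq> U" for A
    using maximal_independent_extension R that by blast
  have sub: "?W A \<subseteq> verts G" if "A \<subseteq> U" for A
    using max[OF that] by (simp add: maximal_independent_set_def independent_set_def)
  have fin: "finite (?W A)" if "A \<subseteq> U" for A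
    using sub[OF that] finite_verts by (rule finite_subset)
  have V_y: "y \<in> V" using y by (simp add: exceptional_def)
  have out: "pendants z \<inter> (U \<union> V) = {}" for z by (auto simp: pendants_def)
  have R_out: "R \<inter> (U \<union> V) = {}" using R(1) out unfolding triangle_vertices_def by blast
  have exc_V: "z \<in> V" if "exceptional G U V z" for z using that by (simp add: exceptional_def)
  \<comment> \<open>\<open>x\<close> and \<open>x'\<close> lie in \<open>?W {x, x'}\<close>,
    everything else on the left in \<open>?W {}\<close>, whose condition on exceptional vertices is
    vacuous.\<close>
  have Un: "?W {x} \<union> ?W {x'} \<subseteq> ?W {} \<union> ?W {x, x'}"
    unfolding extension_def by blast
  \<comment> \<open>Both sides consist of \<open>R\<close>, the leaves of
    \<open>U - {x, x'}\<close>, and the exceptional vertices adjacent to neither \<open>x\<close>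
    nor \<open>x'\<close>.\<close>
  have Int: "?W {x} \<inter> ?W {x'} = ?W {} \<inter> ?W {x, x'}"
  proof (rule set_eqI)
    fix z
    have P: "z \<in> pendants u \<Longrightarrow> z \<in> pendants u' \<Longrightarrow> u \<in> U \<Longrightarrow> u' \<in> U \<Longrightarrow> u = u'" for u u'
      using pendants_disjoint by blast
    consider "z \<in> U" | "z \<in> V" | "z \<in> R" | "z \<notin> U \<union> V" "z \<notin> R" by blast
    then show "z \<in> ?W {x} \<inter> ?W {x'} \<longleftrightarrow> z \<in> ?W {} \<inter> ?W {x, x'}"
    proof cases
      case 1
      then have "z \<notin> V" using parts_disjoint by blast
      with 1 show ?thesis
        using out R_out exc_V x unfolding extension_def by blast
    next
      case 2
      then have "z \<noteq> x" "z \<noteq> x'" using parts_disjoint x by blast+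
      with 2 show ?thesis
        using out R_out unfolding extension_def by blast
    next
      case 3
      then show ?thesis unfolding extension_def by blast
    next
      case 4
      then have "\<not> exceptional G U V z" "z \<noteq> x" "z \<noteq> x'" using exc_V x by blast+
      with 4 show ?thesis
        using P unfolding extension_def by blast
    qed
  qed
  have "y \<notin> ?W {x} \<union> ?W {x'}"
    using V_y e out R_out parts_disjoint x unfolding extension_def by blast
  moreover have "y \<in> ?W {}" using y unfolding extension_def by blast
  moreover have "y \<in> verts G" using V_y parts_subset by blast
  ultimately have "sum c (?W {x} \<union> ?W {x'}) < sum c (?W {} \<union> ?W {x, x'})"
    using Un fin x c by (intro sum_strict_mono2[where b = y]) auto
  \<comment> \<open>By inclusion-exclusion, both pairs have union and intersection weights adding up
    to \<open>s + s\<close>; equal intersections then force equal union weights, against the strict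
    inequality due to \<open>y\<close>.\<close>
  moreover have "sum c (?W {x} \<union> ?W {x'}) + sum c (?W {x} \<inter> ?W {x'}) = s + s"
    using x by (simp add: sum.union_inter fin s max)
  moreover have "sum c (?W {} \<union> ?W {x, x'}) + sum c (?W {} \<inter> ?W {x, x'}) = s + s"
    using x by (simp add: sum.union_inter fin s max)
  ultimately show False using Int by simp
qed

end

theorem theorem4p2:
  fixes G :: "('a, 'b) pre_digraph" and U V :: "'a set"
  assumes "cameron_walker G U V"
  shows "levelable G \<longleftrightarrow> \<not> (\<exists>y. exceptional G U V y)"
  using cameron_walker.levelable_if_no_exceptional[OF assms]
    cameron_walker.no_exceptional_if_levelable[OF assms] by blast

end
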